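(* Let $p,q\ge 2$, $n=p+q$, $1\le h<p$, $1\le l<q$, and let $A=(C_p\oplus C_q)+T(1,n,h+1,n-l)$. Suppose $A$ has finite multiplicative order. Then $A$ is permutation similar to an alternating sign matrix unless one of the following holds (in which case it is not): (i) $p=2$, $q$ is odd, $q\ge 3$ and $l\in\{1,q-1\}$; (ii) $q=2$, $p$ is odd, $p\ge 3$ and $h\in\{1,p-1\}$.
   Context: $C_k$ is the $k\times k$ permutation matrix with $1$ in positions $(i+1,i)$ for $1\le i\le k-1$ and in position $(1,k)$; $\oplus$ denotes matrix direct sum. $T(i_1,j_1,i_2,j_2)$ (with $i_1\ne i_2$, $j_1\ne j_2$) is the $n\times n$ matrix with $1$ in positions $(i_1,j_1),(i_2,j_2)$, $-1$ in positions $(i_1,j_2),(i_2,j_1)$, $0$ elsewhere. An alternating sign matrix is a square $(0,1,-1)$-matrix in which the non-zero entries of each row and column alternate in sign, beginning and ending with $+1$. Matrices $A,B$ are permutation similar if $B=R^TAR$ for a permutation matrix $R$. *)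

theory Defs
  imports "Jordan_Normal_Form.Matrix"
begin

text \<open>
  Matrices are indexed from 0 here, whereas the index arguments of \<open>T_mat\<close> and the positions
  in the usual description of \<open>C_mat\<close> are counted from 1; entry \<open>(i, j)\<close> of a matrix
  is therefore the position \<open>(Suc i, Suc j)\<close> in 1-based counting.
\<close>

definition C_mat :: "nat \<Rightarrow> int mat" where
  "C_mat k = mat k k (\<lambda>(i, j).
     if Suc i = Suc j + 1 \<or> (Suc i = 1 \<and> Suc j = k) then 1 else 0)"

definition T_mat :: "nat \<Rightarrow> nat \<Rightarrow> nat \<Rightarrow> nat \<Rightarrow> nat \<Rightarrow> int mat" where
  "T_mat n i1 j1 i2 j2 = mat n n (\<lambda>(i, j).
     if (Suc i, Suc j) \<in> {(i1, j1), (i2, j2)} then 1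
     else if (Suc i, Suc j) \<in> {(i1, j2), (i2, j1)} then -1
     else 0)"

definition direct_sum_mat :: "int mat \<Rightarrow> int mat \<Rightarrow> int mat" where
  "direct_sum_mat A B = diag_block_mat [A, B]"

definition finite_order_mat :: "int mat \<Rightarrow> bool" where
  "finite_order_mat A \<longleftrightarrow> (\<exists>k\<ge>1. A ^\<^sub>m k = 1\<^sub>m (dim_row A))"

definition permutation_mat :: "nat \<Rightarrow> int mat \<Rightarrow> bool" where
  "permutation_mat n R \<longleftrightarrow> R \<in> carrier_mat n n \<and> elements_mat R \<subseteq> {0, 1} \<and>
     (\<forall>i<n. \<exists>!j. j < n \<and> R $$ (i, j) = 1) \<and>
     (\<forall>j<n. \<exists>!i. i < n \<and> R $$ (i, j) = 1)"

definition permutation_similar :: "int mat \<Rightarrow> int mat \<Rightarrow> bool" where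
  "permutation_similar A B \<longleftrightarrow> square_mat A \<and>
     (\<exists>R. permutation_mat (dim_row A) R \<and> B = transpose_mat R * A * R)"

definition alternating_vec :: "int vec \<Rightarrow> bool" where
  "alternating_vec v \<longleftrightarrow>
     (let xs = filter (\<lambda>x. x \<noteq> 0) (list_of_vec v) in
        xs \<noteq> [] \<and> hd xs = 1 \<and> last xs = 1 \<and>
        (\<forall>k. Suc k < length xs \<longrightarrow> sgn (xs ! Suc k) = - sgn (xs ! k)))"

definition alternating_sign_mat :: "int mat \<Rightarrow> bool" where
  "alternating_sign_mat A \<longleftrightarrow> square_mat A \<and> elements_mat A \<subseteq> {0, 1, -1} \<and>
     (\<forall>i<dim_row A. alternating_vec (row A i)) \<and>
     (\<forall>j<dim_col A. alternating_vec (col A j))"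

end

theory Submission
  imports Defs
begin

text \<open>
  (With 1-based indices.) Conjugating by a permutation matrix amounts to listing the indices in a different order. All rows
  and columns of \<open>A\<close> have a single nonzero entry except rows \<open>1\<close>, \<open>h + 1\<close> and columns \<open>n\<close>, \<open>n - l\<close>,
  which have entries \<open>1, 1, -1\<close>. These four lines alternate in the new order iff, up to reversal,
  the indices \<open>p, n - l, n, h\<close> appear in this order, and so do \<open>p + 1, h + 1, 1, n - l + 1\<close>. The two
  chains share an index exactly when \<open>h = p - 1\<close>, \<open>h = 1\<close>, \<open>l = 1\<close> or \<open>l = q - 1\<close>, and going through
  the possible coincidences shows that the chains are compatible iff at most two of these four
  equations hold. Three of them hold iff \<open>p = 2\<close> and \<open>l \<in> {1, q - 1}\<close>, or \<open>q = 2\<close> and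
  \<open>h \<in> {1, p - 1}\<close>. If moreover \<open>p\<close> and \<open>q\<close> are both even, then \<open>A\<close> has a Jordan chain of length 2
  for the eigenvalue \<open>-1\<close>, so its order is infinite.
\<close>

section \<open>Alternating vectors with at most three nonzero entries\<close>

definition between :: "'a::linorder \<Rightarrow> 'a \<Rightarrow> 'a \<Rightarrow> bool" where
  "between x y z \<longleftrightarrow> x < y \<and> y < z \<or> z < y \<and> y < x"

text \<open>Passing to the ordered support makes alternation a question about a set of indices: once
  the support is known, the filtered list can be written out.\<close>

lemma filter_list_of_vec:
  "filter P (list_of_vec v) = map (($) v) (sorted_list_of_set {i. i < dim_vec v \<and> P (v $ i)})"
proof -
  have "list_of_vec v = map (($) v) [0..<dim_vec v]"
    by (simp add: list_eq_iff_nth_eq list_of_vec_index)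
  moreover have "filter (\<lambda>i. P (v $ i)) [0..<dim_vec v]
      = sorted_list_of_set {i. i < dim_vec v \<and> P (v $ i)}"
    by (rule sorted_distinct_set_unique) (auto simp: sorted_wrt_filter)
  ultimately show ?thesis by (simp add: filter_map o_def)
qed

lemma alternating_vec_single:
  assumes "s < dim_vec v" and "\<And>i. i < dim_vec v \<Longrightarrow> v $ i = (if i = s then 1 else 0)"
  shows "alternating_vec v"
proof -
  have "{i. i < dim_vec v \<and> v $ i \<noteq> 0} = {s}" using assms by (auto split: if_splits)
  then show ?thesis
    using assms by (simp add: alternating_vec_def filter_list_of_vec Let_def)
qed

lemma sorted_list_of_set_3:
  fixes a b c :: nat
  assumes "a < b" "b < c"
  shows "sorted_list_of_set {a, b, c} = [a, b, c]"
  using assms by (intro sorted_distinct_set_unique) auto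

lemma alternating_vec_three_ordered:
  assumes "{i. i < dim_vec v \<and> v $ i \<noteq> 0} = {a, b, c}" "a < b" "b < c"
    and "v $ a \<in> {1, -1}" "v $ b \<in> {1, -1}" "v $ c \<in> {1, -1}"
  shows "alternating_vec v \<longleftrightarrow> v $ a = 1 \<and> v $ b = -1 \<and> v $ c = 1"
proof -
  have xs: "filter (\<lambda>x. x \<noteq> 0) (list_of_vec v) = [v $ a, v $ b, v $ c]"
    using assms(1-3) by (simp add: filter_list_of_vec sorted_list_of_set_3)
  have "(\<forall>k. Suc k < length [x, y, z] \<longrightarrow> sgn ([x, y, z] ! Suc k) = - sgn ([x, y, z] ! k))
      \<longleftrightarrow> sgn y = - sgn x \<and> sgn z = - sgn y" for x y z :: int
    by (auto simp: less_Suc_eq)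
  then have "alternating_vec v \<longleftrightarrow>
      v $ a = 1 \<and> v $ c = 1 \<and> sgn (v $ b) = - sgn (v $ a) \<and> sgn (v $ c) = - sgn (v $ b)"
    unfolding alternating_vec_def xs Let_def by simp
  then show ?thesis
    using assms(4-6) by (elim insertE emptyE) simp_all
qed

text \<open>Of the six possible orders of \<open>s\<close>, \<open>m\<close>, \<open>t\<close>, only
  the two with \<open>m\<close> in the middle give the sign pattern 1, -1, 1. Since
  \<open>between\<close> is symmetric in its outer arguments, it covers both.\<close>

lemma alternating_vec_iff_between:
  assumes "s < dim_vec v" "m < dim_vec v" "t < dim_vec v" "s \<noteq> m" "s \<noteq> t" "m \<noteq> t"
    and v: "\<And>i. i < dim_vec v \<Longrightarrow> v $ i = (if i = s \<or> i = t then 1 else if i = m then -1 else 0)"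
  shows "alternating_vec v \<longleftrightarrow> between s m t"
proof -
  have S: "{i. i < dim_vec v \<and> v $ i \<noteq> 0} = {s, m, t}"
    using assms by (auto split: if_splits)
  have e: "v $ s = 1" "v $ m = -1" "v $ t = 1" using assms by auto
  have ordered: "alternating_vec v \<longleftrightarrow> v $ a = 1 \<and> v $ b = -1 \<and> v $ c = 1"
    if "{a, b, c} = {s, m, t}" "a < b" "b < c" for a b c
  proof (rule alternating_vec_three_ordered)
    have "a \<in> {s, m, t}" "b \<in> {s, m, t}" "c \<in> {s, m, t}" using that by auto
    then show "v $ a \<in> {1, -1}" "v $ b \<in> {1, -1}" "v $ c \<in> {1, -1}" using e by auto
  qed (use that S in auto)
  consider "s < m \<and> m < t" | "t < m \<and> m < s" | "m < s \<and> s < t" | "m < t \<and> t < s"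
    | "s < t \<and> t < m" | "t < s \<and> s < m"
    using assms(4-6) by linarith
  then show ?thesis
  proof cases
    case 1 then show ?thesis using ordered[of s m t] e by (auto simp: between_def)
  next
    case 2 then show ?thesis using ordered[of t m s] e by (auto simp: between_def)
  next
    case 3 then show ?thesis using ordered[of m s t] e by (auto simp: between_def)
  next
    case 4 then show ?thesis using ordered[of m t s] e by (auto simp: between_def)
  next
    case 5 then show ?thesis using ordered[of s t m] e by (auto simp: between_def)
  next
    case 6 then show ?thesis using ordered[of t s m] e by (auto simp: between_def)
  qed
qed

section \<open>Permutation similarity as a reordering of the indices\<close>

text \<open>Column \<open>j\<close> of \<open>R\<close> is the unit vector at
  \<open>\<pi> j\<close>, so each of the two products collapses to a single term.\<close>

lemma congruence_by_permutation_matrix: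
  fixes A R :: "int mat"
  assumes A: "A \<in> carrier_mat n n" and R: "R \<in> carrier_mat n n"
    and \<pi>: "\<And>j. j < n \<Longrightarrow> \<pi> j < n"
    and entries: "\<And>i j. i < n \<Longrightarrow> j < n \<Longrightarrow> R $$ (i, j) = (if i = \<pi> j then 1 else 0)"
  shows "transpose_mat R * A * R = mat n n (\<lambda>(i, j). A $$ (\<pi> i, \<pi> j))"
proof (rule eq_matI)
  fix i j assume "i < dim_row (mat n n (\<lambda>(i, j). A $$ (\<pi> i, \<pi> j)))"
    and "j < dim_col (mat n n (\<lambda>(i, j). A $$ (\<pi> i, \<pi> j)))"
  then have ij: "i < n" "j < n" by auto
  have mult_entry: "(X * R) $$ (i, j) = (\<Sum>k = 0..<n. X $$ (i, k) * R $$ (k, j))"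
    if "X \<in> carrier_mat n n" for X
    using that R ij by (simp add: scalar_prod_def)
  have left: "(transpose_mat R * A) $$ (i, k) = A $$ (\<pi> i, k)" if "k < n" for k
    using A R ij that \<pi>
    by (simp add: scalar_prod_def entries if_distrib[where f = "\<lambda>x. x * _"] sum.delta cong: if_cong)
  have "(transpose_mat R * A * R) $$ (i, j)
      = (\<Sum>k = 0..<n. (transpose_mat R * A) $$ (i, k) * R $$ (k, j))"
    using mult_entry[of "transpose_mat R * A"] A R ij by simp
  also have "\<dots> = (\<Sum>k = 0..<n. if k = \<pi> j then A $$ (\<pi> i, k) else 0)"
    by (intro sum.cong) (auto simp: left entries ij)
  also have "\<dots> = A $$ (\<pi> i, \<pi> j)" using \<pi> ij by (simp add: sum.delta')
  finally show "(transpose_mat R * A * R) $$ (i, j) = mat n n (\<lambda>(i, j). A $$ (\<pi> i, \<pi> j)) $$ (i, j)"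
    using ij by simp
qed (use A R in auto)

text \<open>The unique 1 in column \<open>j\<close> of \<open>R\<close> defines
  \<open>\<pi> j\<close>; uniqueness of the 1 in each row makes \<open>\<pi>\<close> injective,
  hence bijective on a finite set.\<close>

lemma permutation_similar_iff:
  assumes A: "A \<in> carrier_mat n n"
  shows "permutation_similar A B \<longleftrightarrow>
    (\<exists>\<pi>. bij_betw \<pi> {..<n} {..<n} \<and> B = mat n n (\<lambda>(i, j). A $$ (\<pi> i, \<pi> j)))"
proof
  assume "permutation_similar A B"
  then obtain R where "permutation_mat n R" and B: "B = transpose_mat R * A * R"
    using A by (auto simp: permutation_similar_def)
  then have R: "R \<in> carrier_mat n n" and el: "elements_mat R \<subseteq> {0, 1}"
    and row1: "\<And>i. i < n \<Longrightarrow> \<exists>!j. j < n \<and> R $$ (i, j) = 1"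
    and col1: "\<And>j. j < n \<Longrightarrow> \<exists>!i. i < n \<and> R $$ (i, j) = 1"
    by (auto simp: permutation_mat_def)
  have "\<exists>\<pi>. \<forall>j<n. \<pi> j < n \<and> R $$ (\<pi> j, j) = 1"
    using col1 by (intro choice) (metis)
  then obtain \<pi> where \<pi>: "\<And>j. j < n \<Longrightarrow> \<pi> j < n" "\<And>j. j < n \<Longrightarrow> R $$ (\<pi> j, j) = 1"
    by blast
  have "R $$ (i, j) = (if i = \<pi> j then 1 else 0)" if "i < n" "j < n" for i j
  proof -
    have "R $$ (i, j) \<in> {0, 1}" using el R that elements_matI[OF R that] by auto
    then show ?thesis using \<pi> col1 that by (metis empty_iff insert_iff)
  qed
  then have "B = mat n n (\<lambda>(i, j). A $$ (\<pi> i, \<pi> j))"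
    using congruence_by_permutation_matrix[OF A R] \<pi>(1) B by blast
  moreover have "inj_on \<pi> {..<n}"
    using \<pi> row1 by (intro inj_onI) (metis lessThan_iff)
  then have "bij_betw \<pi> {..<n} {..<n}"
    using \<pi>(1) by (intro bij_betw_imageI endo_inj_surj) auto
  ultimately show "\<exists>\<pi>. bij_betw \<pi> {..<n} {..<n} \<and> B = mat n n (\<lambda>(i, j). A $$ (\<pi> i, \<pi> j))"
    by blast
next
  assume "\<exists>\<pi>. bij_betw \<pi> {..<n} {..<n} \<and> B = mat n n (\<lambda>(i, j). A $$ (\<pi> i, \<pi> j))"
  then obtain \<pi> where bij: "bij_betw \<pi> {..<n} {..<n}"
    and B: "B = mat n n (\<lambda>(i, j). A $$ (\<pi> i, \<pi> j))" by blast
  define R :: "int mat" where "R = mat n n (\<lambda>(i, j). if i = \<pi> j then 1 else 0)"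
  have \<pi>: "\<pi> j < n" if "j < n" for j using bij that by (auto simp: bij_betw_def)
  have "\<exists>!j. j < n \<and> R $$ (i, j) = 1" if i: "i < n" for i
  proof -
    have inj: "\<And>k j. k < n \<Longrightarrow> j < n \<Longrightarrow> \<pi> k = \<pi> j \<Longrightarrow> k = j"
      using bij by (auto simp: bij_betw_def inj_on_def)
    have "i \<in> \<pi> ` {..<n}" using bij i by (simp add: bij_betw_def)
    then obtain j where j: "j < n" "i = \<pi> j" by blast
    have "k = j" if "k < n \<and> R $$ (i, k) = 1" for k
      using that i j inj[of k j] by (auto simp: R_def split: if_splits)
    moreover have "R $$ (i, j) = 1" using i j by (simp add: R_def)
    ultimately show ?thesis using j(1) by blast
  qed
  moreover have "\<exists>!i. i < n \<and> R $$ (i, j) = 1" if "j < n" for j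
  proof (rule ex1I[of _ "\<pi> j"])
    show "\<pi> j < n \<and> R $$ (\<pi> j, j) = 1" using that \<pi> by (simp add: R_def)
    show "i = \<pi> j" if "i < n \<and> R $$ (i, j) = 1" for i
    proof (rule ccontr)
      assume "i \<noteq> \<pi> j"
      moreover have "i < n" "R $$ (i, j) = 1" using that by auto
      ultimately show False using \<open>j < n\<close> by (simp add: R_def)
    qed
  qed
  moreover have "elements_mat R \<subseteq> {0, 1}" by (auto simp: R_def elements_mat_def)
  ultimately have "permutation_mat n R" by (auto simp: permutation_mat_def R_def)
  moreover have "B = transpose_mat R * A * R"
    using congruence_by_permutation_matrix[OF A, of R \<pi>] \<pi> by (simp add: R_def B)
  ultimately show "permutation_similar A B" using A by (auto simp: permutation_similar_def)
qed

section \<open>Orders that realise prescribed chains\<close>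

text \<open>The rank of \<open>i\<close> in the lexicographic order by key and then index works.
  Ties are allowed, so a key has to separate only the indices that a chain compares.\<close>

lemma ex_order_preserving_bij:
  fixes g :: "nat \<Rightarrow> 'a::linorder"
  shows "\<exists>\<rho>. bij_betw \<rho> {..<n} {..<n} \<and> (\<forall>i<n. \<forall>j<n. g i < g j \<longrightarrow> \<rho> i < \<rho> j)"
proof -
  define below where "below = (\<lambda>i. {j. j < n \<and> (g j < g i \<or> g j = g i \<and> j < i)})"
  define \<rho> where "\<rho> = (\<lambda>i. card (below i))"
  have mono: "\<rho> i < \<rho> j" if "i < n" "g i < g j \<or> g i = g j \<and> i < j" for i j
    unfolding \<rho>_def by (rule psubset_card_mono) (use that in \<open>auto simp: below_def\<close>)
  have "\<rho> i < n" if "i < n" for i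
  proof -
    have "below i \<subset> {..<n}" using that by (auto simp: below_def)
    from psubset_card_mono[OF _ this] show ?thesis by (simp add: \<rho>_def)
  qed
  moreover have "inj_on \<rho> {..<n}"
    by (intro inj_onI) (metis mono lessThan_iff less_irrefl linorder_less_linear)
  ultimately have "bij_betw \<rho> {..<n} {..<n}"
    by (intro bij_betw_imageI endo_inj_surj) auto
  with mono show ?thesis by blast
qed

text \<open>To be used with \<open>h - 1\<close>, \<open>p - 1\<close>, \<open>n - l - 1\<close>,
  \<open>n - 1\<close> in place of \<open>h\<close>, \<open>p\<close>, \<open>m\<close>,
  \<open>n\<close>. Both excluded coincidences are genuine conflicts: the first would put
  \<open>p\<close> before \<open>m\<close> in one chain and after it in the other, the second does
  the same with \<open>n\<close> and \<open>h\<close>.\<close>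

lemma ex_key_for_chains:
  fixes h p m n :: nat
  assumes "h < p" "p < m" "m < n"
    and "\<not> (p = Suc h \<and> m = Suc p)" "\<not> (h = 0 \<and> n = Suc m)"
  obtains g :: "nat \<Rightarrow> nat" where "g p < g m" "g m < g n" "g n < g h"
    "g (Suc p) < g (Suc h)" "g (Suc h) < g 0" "g 0 < g (Suc m)"
\<comment> \<open>These two equations decide how the chains are interleaved. The other possible
  coincidences, \<open>m = Suc p\<close> and \<open>n = Suc m\<close>, are absorbed, where they are
  not excluded, by giving both indices the same key, sometimes the default one.\<close>
proof (cases "p = Suc h"; cases "h = 0")
  assume "p = Suc h" "h = 0"
  with assms that[of "\<lambda>i. if i = Suc p then 0 else if i = p then 1 else if i = m then 2
    else if i = n then 3 else if i = 0 then 4 else 5"] show thesis by simp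
next
  assume "p = Suc h" "h \<noteq> 0"
  with assms that[of "\<lambda>i. if i = Suc p then 0 else if i = p then 1 else if i = m then 2
    else if i = 0 then 3 else if i = h then 5 else 4"] show thesis by simp
next
  assume "p \<noteq> Suc h" "h = 0"
  with assms that[of "\<lambda>i. if i = p then 0 else if i = m \<or> i = Suc p then 1 else if i = Suc h then 2
    else if i = n then 3 else if i = 0 then 4 else 5"] show thesis by simp
next
  assume "p \<noteq> Suc h" "h \<noteq> 0"
  with assms that[of "\<lambda>i. if i = p then 0 else if i = m \<or> i = Suc p then 1 else if i = Suc h then 2
    else if i = 0 then 3 else if i = h then 5 else 4"] show thesis by simp
qed

section \<open>Jordan chains for the eigenvalue -1 and infinite order\<close>

lemma pow_mat_Suc_left:
  assumes "A \<in> carrier_mat n n"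
  shows "A ^\<^sub>m Suc k = A * A ^\<^sub>m k"
  using assms by (induction k) (auto simp: assoc_mult_mat[of _ n n _ n _ n])

lemma pow_mat_vec_jordan_chain:
  fixes A :: "int mat"
  assumes A: "A \<in> carrier_mat n n" and v: "v \<in> carrier_vec n" and w: "w \<in> carrier_vec n"
    and Aw: "A *\<^sub>v w = - w" and Av: "A *\<^sub>v v = - v + c \<cdot>\<^sub>v w"
  shows "(A ^\<^sub>m k) *\<^sub>v v = (-1) ^ k \<cdot>\<^sub>v (v - (of_nat k * c) \<cdot>\<^sub>v w)"
proof (induction k)
  case 0
  show ?case using A v w by auto
next
  case (Suc k)
  have smult: "A *\<^sub>v (a \<cdot>\<^sub>v u) = a \<cdot>\<^sub>v (A *\<^sub>v u)" if "u \<in> carrier_vec n" for a u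
    using A that by (intro eq_vecI) auto
  have "A ^\<^sub>m Suc k *\<^sub>v v = A *\<^sub>v ((-1) ^ k \<cdot>\<^sub>v (v - (of_nat k * c) \<cdot>\<^sub>v w))"
    using A v Suc.IH unfolding pow_mat_Suc_left[OF A] by (subst assoc_mult_mat_vec) auto
  also have "\<dots> = (-1) ^ k \<cdot>\<^sub>v (A *\<^sub>v v - (of_nat k * c) \<cdot>\<^sub>v (A *\<^sub>v w))"
    using A v w by (simp add: smult mult_minus_distrib_mat_vec[of _ n n])
  also have "\<dots> = (-1) ^ Suc k \<cdot>\<^sub>v (v - (of_nat (Suc k) * c) \<cdot>\<^sub>v w)"
    unfolding Aw Av using v w by (intro eq_vecI) (auto simp: algebra_simps)
  finally show ?case .
qed

text \<open>If the \<open>k\<close>-th power were the identity, coordinate \<open>i\<close> of the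
  power formula would read 0 = k c w_i up to sign, which is impossible for k at least 1.\<close>

lemma infinite_order_by_jordan_chain:
  fixes A :: "int mat"
  assumes A: "A \<in> carrier_mat n n" and v: "v \<in> carrier_vec n" and w: "w \<in> carrier_vec n"
    and Aw: "A *\<^sub>v w = - w" and Av: "A *\<^sub>v v = - v + c \<cdot>\<^sub>v w"
    and i: "i < n" "c \<noteq> 0" "w $ i \<noteq> 0" "v $ i = 0"
  shows "\<not> finite_order_mat A"
proof
  assume "finite_order_mat A"
  then obtain k where k: "k \<ge> 1" "A ^\<^sub>m k = 1\<^sub>m n" using A by (auto simp: finite_order_mat_def)
  have "v = (-1) ^ k \<cdot>\<^sub>v (v - (of_nat k * c) \<cdot>\<^sub>v w)"
    using pow_mat_vec_jordan_chain[OF A v w Aw Av, of k] v k by simp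
  then have "v $ i = ((-1) ^ k \<cdot>\<^sub>v (v - (of_nat k * c) \<cdot>\<^sub>v w)) $ i" by (rule arg_cong)
  then show False using i k v w by simp
qed

lemma transpose_pow_mat:
  fixes A :: "int mat"
  assumes "A \<in> carrier_mat n n"
  shows "transpose_mat A ^\<^sub>m k = transpose_mat (A ^\<^sub>m k)"
proof (induction k)
  case 0
  show ?case using assms by simp
next
  case (Suc k)
  have "transpose_mat (A ^\<^sub>m Suc k) = transpose_mat (A * A ^\<^sub>m k)"
    using pow_mat_Suc_left[OF assms] by simp
  then show ?case using Suc assms by (simp add: transpose_mult[of _ n n _ n])
qed

text \<open>Lets a Jordan chain of the transpose refute finite order of the matrix itself.\<close>

lemma finite_order_transpose:
  assumes "A \<in> carrier_mat n n" "finite_order_mat A"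
  shows "finite_order_mat (transpose_mat A)"
  using assms by (auto simp: finite_order_mat_def transpose_pow_mat)

section \<open>The entries of the matrix built from two linked cycles\<close>

text \<open>The ones of a direct sum of two cycles of lengths \<open>p\<close> and \<open>n - p\<close> are at the positions
  \<open>(i, cycle_col p n i)\<close>, which are the positions \<open>(cycle_row p n j, j)\<close>. All indices count from 0
  from here on, so the special rows are \<open>0\<close> and \<open>h\<close>, the special columns \<open>n - 1\<close> and \<open>n - l - 1\<close>.\<close>

definition cycle_col :: "nat \<Rightarrow> nat \<Rightarrow> nat \<Rightarrow> nat" where
  "cycle_col p n i = (if i = 0 then p - 1 else if i = p then n - 1 else i - 1)"

definition cycle_row :: "nat \<Rightarrow> nat \<Rightarrow> nat \<Rightarrow> nat" where
  "cycle_row p n j = (if j = p - 1 then 0 else if j = n - 1 then p else Suc j)"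

lemma direct_sum_cycles_entry:
  assumes "p \<ge> 1" "q \<ge> 1" "i < p + q" "j < p + q"
  shows "direct_sum_mat (C_mat p) (C_mat q) $$ (i, j) = (if j = cycle_col p (p + q) i then 1 else 0)"
proof -
  have C: "C_mat k $$ (a, b) = (if a = Suc b \<or> a = 0 \<and> Suc b = k then 1 else 0)"
    if "a < k" "b < k" for k a b
    using that by (simp add: C_mat_def)
  have dim: "dim_row (C_mat k) = k" "dim_col (C_mat k) = k" for k by (simp_all add: C_mat_def)
  have lt: "i - p < q" "j - p < q" using assms by auto
  have "direct_sum_mat (C_mat p) (C_mat q) $$ (i, j) =
      (if i < p then if j < p then C_mat p $$ (i, j) else 0
       else if j < p then 0 else C_mat q $$ (i - p, j - p))"
    using assms lt by (simp add: direct_sum_mat_def Let_def dim)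
  also have "\<dots> = (if j = cycle_col p (p + q) i then 1 else 0)"
  proof (cases "i < p"; cases "j < p")
    assume "i < p" "j < p"
    then show ?thesis using assms by (simp add: C) (auto simp: cycle_col_def)
  next
    assume "\<not> i < p" "\<not> j < p"
    then show ?thesis using assms by (simp add: C) (auto simp: cycle_col_def)
  qed (use assms in \<open>auto simp: cycle_col_def\<close>)
  finally show ?thesis .
qed

locale linked_cycles =
  fixes p q n h l :: nat and A :: "int mat"
  assumes p: "p \<ge> 2" and q: "q \<ge> 2" and n: "n = p + q"
    and h: "1 \<le> h" "h < p" and l: "1 \<le> l" "l < q"
    and A: "A = direct_sum_mat (C_mat p) (C_mat q) + T_mat n 1 n (h + 1) (n - l)"
begin

lemma A_carrier: "A \<in> carrier_mat n n"
  by (rule carrier_matI) (simp_all add: A T_mat_def)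

abbreviation col1 :: "nat \<Rightarrow> nat" where "col1 \<equiv> cycle_col p n"

abbreviation row1 :: "nat \<Rightarrow> nat" where "row1 \<equiv> cycle_row p n"

lemma bounds: "0 < h" "h < p" "p \<le> n - l - 1" "n - l - 1 < n - 1" "p < n - 1"
  using p q n h l by auto

text \<open>Both functions describe the same permutation, read by rows or by columns, so the
  row-based entry formula can also be used along columns.\<close>

lemma row1_iff: "i < n \<Longrightarrow> j < n \<Longrightarrow> i = row1 j \<longleftrightarrow> j = col1 i"
  using bounds(1,2,5) by (cases "i = 0"; cases "i = p") (auto simp: cycle_row_def cycle_col_def)

lemma T_entry:
  "i < n \<Longrightarrow> j < n \<Longrightarrow> T_mat n 1 n (h + 1) (n - l) $$ (i, j) =
    (if i = 0 \<and> j = n - 1 \<or> i = h \<and> j = n - l - 1 then 1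
     else if i = 0 \<and> j = n - l - 1 \<or> i = h \<and> j = n - 1 then -1 else 0)"
proof -
  assume "i < n" "j < n"
  moreover have "Suc j = n \<longleftrightarrow> j = n - 1" "Suc j = n - l \<longleftrightarrow> j = n - l - 1"
    "Suc (n - l - 1) = n - l" "0 < h" "1 < n"
    using bounds by auto
  ultimately show ?thesis by (simp add: T_mat_def)
qed

lemma entry:
  assumes "i < n" "j < n"
  shows "A $$ (i, j) = (if j = col1 i then 1 else 0) +
    (if i = 0 \<and> j = n - 1 \<or> i = h \<and> j = n - l - 1 then 1
     else if i = 0 \<and> j = n - l - 1 \<or> i = h \<and> j = n - 1 then -1 else 0)"
proof -
  have "direct_sum_mat (C_mat p) (C_mat q) $$ (i, j) = (if j = col1 i then 1 else 0)"
    using direct_sum_cycles_entry[of p q i j] assms p q by (simp add: n)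
  moreover have "A $$ (i, j) = direct_sum_mat (C_mat p) (C_mat q) $$ (i, j)
      + T_mat n 1 n (h + 1) (n - l) $$ (i, j)"
    using assms by (simp add: A T_mat_def)
  ultimately show ?thesis using T_entry[OF assms] by simp
qed

text \<open>The four nonzero positions of \<open>T_mat\<close> have row index less than
  \<open>p\<close> and column index at least \<open>p\<close>. The direct sum vanishes there, so
  nothing cancels or adds up to 2.\<close>

lemma special_lines:
  assumes "i < n"
  shows "A $$ (0, i) = (if i = p - 1 \<or> i = n - 1 then 1 else if i = n - l - 1 then -1 else 0)"
    and "A $$ (h, i) = (if i = h - 1 \<or> i = n - l - 1 then 1 else if i = n - 1 then -1 else 0)"
    and "A $$ (i, n - 1) = (if i = p \<or> i = 0 then 1 else if i = h then -1 else 0)"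
    and "A $$ (i, n - l - 1) = (if i = n - l \<or> i = h then 1 else if i = 0 then -1 else 0)"
proof -
  have lt: "0 < n" "h < n" "n - 1 < n" "n - l - 1 < n" using bounds by auto
  have neq: "p - 1 \<noteq> n - l - 1" "p - 1 \<noteq> n - 1" "n - l - 1 \<noteq> n - 1" "h - 1 \<noteq> n - l - 1"
    "h - 1 \<noteq> n - 1" "h \<noteq> p" "p \<noteq> 0" "h \<noteq> 0" "n - l \<noteq> 0" "n - l \<noteq> h"
    using bounds by auto
  have merge: "(if P then 1 else 0) + (if Q then 1 else if R then -1 else 0)
      = (if P \<or> Q then 1 else if R then -1 else 0 :: int)" if "\<not> (P \<and> Q)" "\<not> (P \<and> R)" for P Q R
    using that by simp
  have cols: "col1 0 = p - 1" "col1 h = h - 1" using neq by (simp_all add: cycle_col_def)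
  have "A $$ (0, i) = (if i = p - 1 then 1 else 0)
      + (if i = n - 1 then 1 else if i = n - l - 1 then -1 else 0)"
    using neq(8) by (simp add: entry[OF lt(1) assms] cols)
  also have "\<dots> = (if i = p - 1 \<or> i = n - 1 then 1 else if i = n - l - 1 then -1 else 0)"
    using neq by (intro merge) metis+
  finally show "A $$ (0, i) = (if i = p - 1 \<or> i = n - 1 then 1 else if i = n - l - 1 then -1 else 0)" .
  have "A $$ (h, i) = (if i = h - 1 then 1 else 0)
      + (if i = n - l - 1 then 1 else if i = n - 1 then -1 else 0)"
    using neq(8) by (simp add: entry[OF lt(2) assms] cols)
  also have "\<dots> = (if i = h - 1 \<or> i = n - l - 1 then 1 else if i = n - 1 then -1 else 0)"
    using neq by (intro merge) metis+
  finally show "A $$ (h, i) = (if i = h - 1 \<or> i = n - l - 1 then 1 else if i = n - 1 then -1 else 0)" .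
  have "Suc (n - l - 1) = n - l" using bounds by auto
  then have "row1 (n - 1) = p" "row1 (n - l - 1) = n - l"
    using neq(1-3) unfolding cycle_row_def by metis+
  then have rows: "n - 1 = col1 i \<longleftrightarrow> i = p" "n - l - 1 = col1 i \<longleftrightarrow> i = n - l"
    using row1_iff[OF assms lt(3)] row1_iff[OF assms lt(4)] by metis+
  have "A $$ (i, n - 1) = (if i = p then 1 else 0) + (if i = 0 then 1 else if i = h then -1 else 0)"
    unfolding entry[OF assms lt(3)] rows using neq(3) by auto
  also have "\<dots> = (if i = p \<or> i = 0 then 1 else if i = h then -1 else 0)"
    using neq by (intro merge) metis+
  finally show "A $$ (i, n - 1) = (if i = p \<or> i = 0 then 1 else if i = h then -1 else 0)" .
  have "A $$ (i, n - l - 1)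
      = (if i = n - l then 1 else 0) + (if i = h then 1 else if i = 0 then -1 else 0)"
    unfolding entry[OF assms lt(4)] rows using neq(3) by auto
  also have "\<dots> = (if i = n - l \<or> i = h then 1 else if i = 0 then -1 else 0)"
    using neq by (intro merge) metis+
  finally show "A $$ (i, n - l - 1) = (if i = n - l \<or> i = h then 1 else if i = 0 then -1 else 0)" .
qed

section \<open>The order conditions for an alternating sign matrix\<close>

text \<open>Here \<open>\<rho> i\<close> is the new position of index \<open>i\<close>, with one
  conjunct for each special line. The first two together put \<open>p - 1\<close>,
  \<open>n - l - 1\<close>, \<open>n - 1\<close>, \<open>h - 1\<close> in this order up to reversal;
  the last two do so for \<open>p\<close>, \<open>h\<close>, \<open>0\<close>,
  \<open>n - l\<close>.\<close>

definition admissible :: "(nat \<Rightarrow> nat) \<Rightarrow> bool" where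
  "admissible \<rho> \<longleftrightarrow>
     between (\<rho> (p - 1)) (\<rho> (n - l - 1)) (\<rho> (n - 1)) \<and>
     between (\<rho> (h - 1)) (\<rho> (n - 1)) (\<rho> (n - l - 1)) \<and>
     between (\<rho> p) (\<rho> h) (\<rho> 0) \<and>
     between (\<rho> (n - l)) (\<rho> 0) (\<rho> h)"

lemma alternating_permuted_iff:
  assumes \<pi>: "bij_betw \<pi> {..<n} {..<n}" and \<rho>: "bij_betw \<rho> {..<n} {..<n}"
    and inv: "\<And>i. i < n \<Longrightarrow> \<rho> (\<pi> i) = i" "\<And>i. i < n \<Longrightarrow> \<pi> (\<rho> i) = i"
  shows "alternating_sign_mat (mat n n (\<lambda>(i, j). A $$ (\<pi> i, \<pi> j))) \<longleftrightarrow> admissible \<rho>"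
proof -
  let ?B = "mat n n (\<lambda>(i, j). A $$ (\<pi> i, \<pi> j))"
  have \<pi>n: "\<pi> i < n" and \<rho>n: "\<rho> i < n" if "i < n" for i
    using \<pi> \<rho> that by (auto simp: bij_betw_def)
  have eq_iff: "j = \<rho> c \<longleftrightarrow> \<pi> j = c" if "j < n" "c < n" for j c
    using inv that by auto
  have \<rho>_inj: "\<rho> i = \<rho> j \<longleftrightarrow> i = j" if "i < n" "j < n" for i j
    using inv that by metis
  have lt: "0 < n" "h < n" "n - 1 < n" "n - l - 1 < n" "p - 1 < n" "h - 1 < n" "p < n" "n - l < n"
    and neq: "p - 1 \<noteq> n - l - 1" "p - 1 \<noteq> n - 1" "n - l - 1 \<noteq> n - 1" "h - 1 \<noteq> n - l - 1"
      "h - 1 \<noteq> n - 1" "p \<noteq> h" "p \<noteq> 0" "h \<noteq> 0" "n - l \<noteq> 0" "n - l \<noteq> h"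
    using bounds by auto
  \<comment> \<open>Outside the special lines \<open>T_mat\<close> is zero, and only the single 1 of
    the cycle permutation remains.\<close>
  have single_row: "alternating_vec (row ?B i)" if "i < n" "\<pi> i \<noteq> 0" "\<pi> i \<noteq> h" for i
  proof (rule alternating_vec_single[where s = "\<rho> (col1 (\<pi> i))"])
    have c: "col1 (\<pi> i) < n" using \<pi>n[OF that(1)] n p q by (auto simp: cycle_col_def)
    then show "\<rho> (col1 (\<pi> i)) < dim_vec (row ?B i)" using \<rho>n by simp
    fix j assume "j < dim_vec (row ?B i)"
    then have "j < n" by simp
    then show "row ?B i $ j = (if j = \<rho> (col1 (\<pi> i)) then 1 else 0)"
      using that c by (simp add: entry \<pi>n eq_iff)
  qed
  have single_col: "alternating_vec (col ?B j)"
    if "j < n" "\<pi> j \<noteq> n - 1" "\<pi> j \<noteq> n - l - 1" for j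
  proof (rule alternating_vec_single[where s = "\<rho> (row1 (\<pi> j))"])
    have c: "row1 (\<pi> j) < n" using \<pi>n[OF that(1)] n p q by (auto simp: cycle_row_def)
    then show "\<rho> (row1 (\<pi> j)) < dim_vec (col ?B j)" using \<rho>n by simp
    fix i assume "i < dim_vec (col ?B j)"
    then have "i < n" by simp
    then show "col ?B j $ i = (if i = \<rho> (row1 (\<pi> j)) then 1 else 0)"
      using that c by (simp add: entry \<pi>n eq_iff row1_iff)
  qed
  have line_entries: "row ?B (\<rho> r) $ j = A $$ (r, \<pi> j)" "col ?B (\<rho> r) $ j = A $$ (\<pi> j, r)"
    if "r < n" "j < n" for r j
    using that by (simp_all add: \<rho>n inv)
  have row_0: "alternating_vec (row ?B (\<rho> 0)) \<longleftrightarrow>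
      between (\<rho> (p - 1)) (\<rho> (n - l - 1)) (\<rho> (n - 1))"
  proof (rule alternating_vec_iff_between)
    fix j assume "j < dim_vec (row ?B (\<rho> 0))"
    then have "j < n" by simp
    then show "row ?B (\<rho> 0) $ j = (if j = \<rho> (p - 1) \<or> j = \<rho> (n - 1) then 1
        else if j = \<rho> (n - l - 1) then -1 else 0)"
      by (simp only: line_entries special_lines \<pi>n eq_iff lt)
  qed (simp_all only: index_row dim_col dim_row_mat dim_col_mat \<rho>n \<rho>_inj lt neq neq[symmetric]
      not_False_eq_True)
  have row_h: "alternating_vec (row ?B (\<rho> h)) \<longleftrightarrow>
      between (\<rho> (h - 1)) (\<rho> (n - 1)) (\<rho> (n - l - 1))"
  proof (rule alternating_vec_iff_between)
    fix j assume "j < dim_vec (row ?B (\<rho> h))"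
    then have "j < n" by simp
    then show "row ?B (\<rho> h) $ j = (if j = \<rho> (h - 1) \<or> j = \<rho> (n - l - 1) then 1
        else if j = \<rho> (n - 1) then -1 else 0)"
      by (simp only: line_entries special_lines \<pi>n eq_iff lt)
  qed (simp_all only: index_row dim_col dim_row_mat dim_col_mat \<rho>n \<rho>_inj lt neq neq[symmetric]
      not_False_eq_True)
  have col_n: "alternating_vec (col ?B (\<rho> (n - 1))) \<longleftrightarrow> between (\<rho> p) (\<rho> h) (\<rho> 0)"
  proof (rule alternating_vec_iff_between)
    fix i assume "i < dim_vec (col ?B (\<rho> (n - 1)))"
    then have "i < n" by simp
    then show "col ?B (\<rho> (n - 1)) $ i = (if i = \<rho> p \<or> i = \<rho> 0 then 1
        else if i = \<rho> h then -1 else 0)"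
      by (simp only: line_entries special_lines \<pi>n eq_iff lt)
  qed (simp_all only: index_row dim_col dim_row_mat dim_col_mat \<rho>n \<rho>_inj lt neq neq[symmetric]
      not_False_eq_True)
  have col_nl: "alternating_vec (col ?B (\<rho> (n - l - 1))) \<longleftrightarrow>
      between (\<rho> (n - l)) (\<rho> 0) (\<rho> h)"
  proof (rule alternating_vec_iff_between)
    fix i assume "i < dim_vec (col ?B (\<rho> (n - l - 1)))"
    then have "i < n" by simp
    then show "col ?B (\<rho> (n - l - 1)) $ i = (if i = \<rho> (n - l) \<or> i = \<rho> h then 1
        else if i = \<rho> 0 then -1 else 0)"
      by (simp only: line_entries special_lines \<pi>n eq_iff lt)
  qed (simp_all only: index_row dim_col dim_row_mat dim_col_mat \<rho>n \<rho>_inj lt neq neq[symmetric]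
      not_False_eq_True)
  have entries: "A $$ (i, j) \<in> {0, 1, -1}" if "i < n" "j < n" for i j
  proof -
    have "(if P then 1 else if Q then -1 else 0) \<in> {0, 1, -1::int}" for P Q by simp
    moreover have "A $$ (i, j) = (if j = col1 i then 1 else 0)" if "i \<noteq> 0" "i \<noteq> h"
      unfolding entry[OF \<open>i < n\<close> \<open>j < n\<close>] using that by simp
    ultimately show ?thesis using special_lines(1,2)[OF that(2)] by metis
  qed
  have "x \<in> {0, 1, -1}" if x: "x \<in> elements_mat ?B" for x
  proof -
    obtain i j where "i < n" "j < n" "x = ?B $$ (i, j)" using elements_matD[OF x] by auto
    then have "x = A $$ (\<pi> i, \<pi> j)" by simp
    with \<open>i < n\<close> \<open>j < n\<close> entries \<pi>n show ?thesis by blast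
  qed
  then have elements: "elements_mat ?B \<subseteq> {0, 1, -1}" by blast
  \<comment> \<open>Exactly the positions \<open>\<rho> a\<close> and \<open>\<rho> b\<close> carry
    the lines \<open>a\<close> and \<open>b\<close>, so only these two have to be tested.\<close>
  have all_iff: "(\<forall>i<n. P i) \<longleftrightarrow> P (\<rho> a) \<and> P (\<rho> b)"
    if "a < n" "b < n" "\<And>i. i < n \<Longrightarrow> \<pi> i \<noteq> a \<Longrightarrow> \<pi> i \<noteq> b \<Longrightarrow> P i" for P a b
    using that inv \<rho>n by metis
  have rows: "(\<forall>i<n. alternating_vec (row ?B i)) \<longleftrightarrow>
      alternating_vec (row ?B (\<rho> 0)) \<and> alternating_vec (row ?B (\<rho> h))"
    using lt(1,2) single_row by (rule all_iff)
  have cols: "(\<forall>j<n. alternating_vec (col ?B j)) \<longleftrightarrow>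
      alternating_vec (col ?B (\<rho> (n - 1))) \<and> alternating_vec (col ?B (\<rho> (n - l - 1)))"
    using lt(3,4) single_col by (rule all_iff)
  show ?thesis
    using elements rows cols row_0 row_h col_n col_nl
    by (simp add: alternating_sign_mat_def admissible_def)
qed

lemma similar_to_asm_iff:
  "(\<exists>B. permutation_similar A B \<and> alternating_sign_mat B) \<longleftrightarrow>
    (\<exists>\<rho>. bij_betw \<rho> {..<n} {..<n} \<and> admissible \<rho>)"
proof
  assume "\<exists>B. permutation_similar A B \<and> alternating_sign_mat B"
  then obtain \<pi> where \<pi>: "bij_betw \<pi> {..<n} {..<n}"
    and asm: "alternating_sign_mat (mat n n (\<lambda>(i, j). A $$ (\<pi> i, \<pi> j)))"
    using permutation_similar_iff[OF A_carrier] by auto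
  let ?\<rho> = "inv_into {..<n} \<pi>"
  have "admissible ?\<rho>"
    using \<pi> asm
    by (subst alternating_permuted_iff[symmetric, OF \<pi>])
      (auto simp: bij_betw_inv_into bij_betw_inv_into_left bij_betw_inv_into_right)
  then show "\<exists>\<rho>. bij_betw \<rho> {..<n} {..<n} \<and> admissible \<rho>"
    using bij_betw_inv_into[OF \<pi>] by blast
next
  assume "\<exists>\<rho>. bij_betw \<rho> {..<n} {..<n} \<and> admissible \<rho>"
  then obtain \<rho> where \<rho>: "bij_betw \<rho> {..<n} {..<n}" "admissible \<rho>" by blast
  let ?\<pi> = "inv_into {..<n} \<rho>"
  have "alternating_sign_mat (mat n n (\<lambda>(i, j). A $$ (?\<pi> i, ?\<pi> j)))"
    using \<rho>
    by (subst alternating_permuted_iff[OF bij_betw_inv_into[OF \<rho>(1)] \<rho>(1)])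
      (auto simp: bij_betw_inv_into_left bij_betw_inv_into_right)
  then show "\<exists>B. permutation_similar A B \<and> alternating_sign_mat B"
    using permutation_similar_iff[OF A_carrier] bij_betw_inv_into[OF \<rho>(1)] by blast
qed

text \<open>Reversing the whole order preserves admissibility, so the first chain may be taken
  increasing, while the second may run either way.\<close>

lemma ex_admissible:
  fixes g :: "nat \<Rightarrow> nat"
  assumes "g (p - 1) < g (n - l - 1)" "g (n - l - 1) < g (n - 1)" "g (n - 1) < g (h - 1)"
    and "g p < g h \<and> g h < g 0 \<and> g 0 < g (n - l) \<or> g (n - l) < g 0 \<and> g 0 < g h \<and> g h < g p"
  shows "\<exists>\<rho>. bij_betw \<rho> {..<n} {..<n} \<and> admissible \<rho>"
proof -
  obtain \<rho> where \<rho>: "bij_betw \<rho> {..<n} {..<n}"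
    and mono: "\<And>i j. i < n \<Longrightarrow> j < n \<Longrightarrow> g i < g j \<Longrightarrow> \<rho> i < \<rho> j"
    using ex_order_preserving_bij[of n g] by blast
  have "p - 1 < n" "n - l - 1 < n" "n - 1 < n" "h - 1 < n" "p < n" "h < n" "0 < n" "n - l < n"
    using p q n h l by auto
  then have "admissible \<rho>"
    using assms(4) mono assms(1-3) unfolding admissible_def between_def by meson
  with \<rho> show ?thesis by blast
qed

text \<open>In each exceptional case the two chains share at least three indices, in orders that are
  neither equal nor reverse to each other. Parity does not enter yet.\<close>

lemma admissible_exists_iff:
  "(\<exists>\<rho>. bij_betw \<rho> {..<n} {..<n} \<and> admissible \<rho>) \<longleftrightarrow>
    \<not> (p = 2 \<and> l \<in> {1, q - 1} \<or> q = 2 \<and> h \<in> {1, p - 1})"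
proof
  assume "\<exists>\<rho>. bij_betw \<rho> {..<n} {..<n} \<and> admissible \<rho>"
  then obtain \<rho> where \<rho>: "admissible \<rho>" by blast
  show "\<not> (p = 2 \<and> l \<in> {1, q - 1} \<or> q = 2 \<and> h \<in> {1, p - 1})"
  proof
    assume "p = 2 \<and> l \<in> {1, q - 1} \<or> q = 2 \<and> h \<in> {1, p - 1}"
    then consider "p = 2" "l = 1" | "p = 2" "l = q - 1" | "q = 2" "h = 1" | "q = 2" "h = p - 1"
      by blast
    then show False
    proof cases
      case 1
      then have "h = 1" "n - l = n - 1" using h l by auto
      with 1 \<rho> show False unfolding admissible_def between_def by auto
    next
      case 2
      then have "h = 1" "n - l - 1 = p" using h l n by auto
      with 2 \<rho> show False unfolding admissible_def between_def by auto
    next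
      case 3
      then have "l = 1" "n - l - 1 = p" "n - l = n - 1" using h l n by auto
      with 3 \<rho> show False unfolding admissible_def between_def by auto
    next
      case 4
      then have "l = 1" "n - l - 1 = p" "n - l = n - 1" using h l n by auto
      with 4 \<rho> show False unfolding admissible_def between_def by auto
    qed
  qed
next
  assume *: "\<not> (p = 2 \<and> l \<in> {1, q - 1} \<or> q = 2 \<and> h \<in> {1, p - 1})"
  note facts = p q n h l
  \<comment> \<open>An increasing second chain fails exactly for the two conflicts excluded in
    \<open>ex_key_for_chains\<close>; there the second chain is taken decreasing.\<close>
  consider (down1) "h = p - 1" "l = q - 1" | (down2) "h = 1" "l = 1"
    | (up) "\<not> (h = p - 1 \<and> l = q - 1)" "\<not> (h = 1 \<and> l = 1)" by blast
  then show "\<exists>\<rho>. bij_betw \<rho> {..<n} {..<n} \<and> admissible \<rho>"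
  proof cases
    case down1
    define x y where "x = h - 1" and "y = n - 1"
    have eqs: "h = Suc x" "p = Suc (Suc x)" "n - l = Suc p" "n - l - 1 = p" "p - 1 = h"
      and less: "0 < x" "Suc p < y"
      using down1 * facts by (auto simp: x_def y_def)
    \<comment> \<open>The reversed second chain \<open>Suc p\<close>, \<open>0\<close>,
      \<open>h\<close>, \<open>p\<close> ends with the pair \<open>h\<close>, \<open>p\<close> that
      starts the first chain \<open>h\<close>, \<open>p\<close>, \<open>y\<close>, \<open>x\<close>.
      The key glues them along this pair, with \<open>x\<close> at the default 5.\<close>
    define g :: "nat \<Rightarrow> nat" where "g = (\<lambda>i. if i = Suc p then 0 else if i = 0 then 1
      else if i = h then 2 else if i = p then 3 else if i = y then 4 else 5)"
    have "g h < g p" "g p < g y" "g y < g x" "g (Suc p) < g 0" "g 0 < g h"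
      using less unfolding g_def eqs(1,2) by simp_all
    then show ?thesis
      by (intro ex_admissible[of g]) (simp_all only: eqs(3-5) x_def y_def diff_Suc_1 simp_thms)
  next
    case down2
    define x y where "x = p - 1" and "y = n - 1"
    have eqs: "p = Suc x" "n - l = y" "h = 1"
      and less: "1 < x" "p < n - l - 1" "n - l - 1 < y"
      using down2 * facts by (auto simp: x_def y_def)
    define m where "m = n - l - 1"
    \<comment> \<open>Now the first chain \<open>x\<close>, \<open>m\<close>, \<open>y\<close>,
      \<open>0\<close> ends with the pair \<open>y\<close>, \<open>0\<close> that starts the
      reversed second chain \<open>y\<close>, \<open>0\<close>, \<open>1\<close>, \<open>p\<close>;
      here \<open>p\<close> gets the default 5.\<close>
    define g :: "nat \<Rightarrow> nat" where "g = (\<lambda>i. if i = x then 0 else if i = m then 1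
      else if i = y then 2 else if i = 0 then 3 else if i = 1 then 4 else 5)"
    have "g x < g m" "g m < g y" "g y < g 0" "g 0 < g 1" "g 1 < g p"
      using less unfolding m_def[symmetric] g_def eqs(1) by simp_all
    then show ?thesis
      by (intro ex_admissible[of g])
        (simp_all only: eqs(2,3) x_def y_def m_def diff_self_eq_0 simp_thms)
  next
    case up
    have "h - 1 < p - 1" "p - 1 < n - l - 1" "n - l - 1 < n - 1"
      "\<not> (p - 1 = Suc (h - 1) \<and> n - l - 1 = Suc (p - 1))"
      "\<not> (h - 1 = 0 \<and> n - 1 = Suc (n - l - 1))"
      using up facts by auto
    then obtain g :: "nat \<Rightarrow> nat" where "g (p - 1) < g (n - l - 1)" "g (n - l - 1) < g (n - 1)"
      "g (n - 1) < g (h - 1)" "g (Suc (p - 1)) < g (Suc (h - 1))" "g (Suc (h - 1)) < g 0"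
      "g 0 < g (Suc (n - l - 1))"
      by (rule ex_key_for_chains)
    moreover have "Suc (p - 1) = p" "Suc (h - 1) = h" "Suc (n - l - 1) = n - l"
      using facts by auto
    ultimately show ?thesis by (intro ex_admissible[of g]) (simp_all only: simp_thms)
  qed
qed

section \<open>Infinite order in the exceptional cases with even cycle lengths\<close>

lemma mult_vec_entry:
  assumes "v \<in> carrier_vec n" "i < n"
  shows "(A *\<^sub>v v) $ i = v $ col1 i + (if i = 0 then v $ (n - 1) - v $ (n - l - 1) else 0)
    + (if i = h then v $ (n - l - 1) - v $ (n - 1) else 0)"
proof -
  have "col1 i < n" using assms p q n by (auto simp: cycle_col_def)
  have "(A *\<^sub>v v) $ i = (\<Sum>j = 0..<n. A $$ (i, j) * v $ j)"
    using assms A_carrier by (simp add: scalar_prod_def)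
  \<comment> \<open>Each summand is split into three terms, each supported at one index, so that
    every sum collapses.\<close>
  also have "\<dots> = (\<Sum>j = 0..<n. (if j = col1 i then v $ j else 0)
      + ((if j = n - 1 then if i = 0 then v $ j else if i = h then - v $ j else 0 else 0)
      + (if j = n - l - 1 then if i = 0 then - v $ j else if i = h then v $ j else 0 else 0)))"
    by (intro sum.cong) (use assms bounds in \<open>auto simp: entry\<close>)
  also have "\<dots> = v $ col1 i + (if i = 0 then v $ (n - 1) - v $ (n - l - 1) else 0)
    + (if i = h then v $ (n - l - 1) - v $ (n - 1) else 0)"
    using \<open>col1 i < n\<close> p h n by (simp add: sum.distrib)
  finally show ?thesis .
qed

lemma transpose_mult_vec_entry:
  assumes "v \<in> carrier_vec n" "j < n"
  shows "(transpose_mat A *\<^sub>v v) $ j = v $ row1 j + (if j = n - 1 then v $ 0 - v $ h else 0)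
    + (if j = n - l - 1 then v $ h - v $ 0 else 0)"
proof -
  have "row1 j < n" using assms p q n by (auto simp: cycle_row_def)
  have "(transpose_mat A *\<^sub>v v) $ j = (\<Sum>i = 0..<n. A $$ (i, j) * v $ i)"
    using assms A_carrier by (simp add: scalar_prod_def)
  also have "\<dots> = (\<Sum>i = 0..<n. (if i = row1 j then v $ i else 0)
      + ((if i = 0 then if j = n - 1 then v $ i else if j = n - l - 1 then - v $ i else 0 else 0)
      + (if i = h then if j = n - 1 then - v $ i else if j = n - l - 1 then v $ i else 0 else 0)))"
    by (intro sum.cong) (use assms bounds in \<open>auto simp: entry row1_iff\<close>)
  also have "\<dots> = v $ row1 j + (if j = n - 1 then v $ 0 - v $ h else 0)
    + (if j = n - l - 1 then v $ h - v $ 0 else 0)"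
    using \<open>row1 j < n\<close> bounds by (auto simp: sum.distrib)
  finally show ?thesis .
qed

text \<open>The vectors are the alternating sign vectors of the cycles: \<open>w\<close> of the
  2-cycle, \<open>v\<close> of the even cycle of length \<open>q\<close>. Both cycles negate them.
  \<open>T_mat\<close> kills \<open>w\<close> and sends \<open>v\<close> to \<open>-2\<close> times
  \<open>w\<close>, because \<open>l\<close> is odd and \<open>v\<close> is therefore -1 at
  \<open>n - 1\<close> and 1 at \<open>n - l - 1\<close>.\<close>

lemma infinite_order_p2:
  assumes "p = 2" "even q" "l \<in> {1, q - 1}"
  shows "\<not> finite_order_mat A"
proof (rule infinite_order_by_jordan_chain[where i = 0 and c = "-2"
      and v = "vec n (\<lambda>i. if i < 2 then 0 else (-1) ^ i)"
      and w = "vec n (\<lambda>i. if i = 0 then 1 else if i = 1 then -1 else 0)"])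
  have odd: "odd l" "h = 1" "even n" "odd (n - 1)" "even (n - l - 1)" "n - l - 1 \<ge> 2"
    using assms q n h l by auto
  show "A *\<^sub>v vec n (\<lambda>i. if i = 0 then 1 else if i = 1 then -1 else 0)
      = - vec n (\<lambda>i. if i = 0 then 1 else if i = 1 then -1 else 0)"
    by (rule eq_vecI) (use A_carrier assms odd q n in
      \<open>auto simp: mult_vec_entry cycle_col_def simp del: index_mult_mat_vec\<close>)
  show "A *\<^sub>v vec n (\<lambda>i. if i < 2 then 0 else (-1) ^ i)
      = - vec n (\<lambda>i. if i < 2 then 0 else (-1) ^ i)
        + (- 2) \<cdot>\<^sub>v vec n (\<lambda>i. if i = 0 then 1 else if i = 1 then -1 else 0)"
    by (rule eq_vecI) (use A_carrier assms odd q n in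
      \<open>auto simp: mult_vec_entry cycle_col_def minus_one_power_iff simp del: index_mult_mat_vec\<close>)
qed (use A_carrier n p in auto)

text \<open>Now \<open>v\<close> lives on the first cycle and \<open>w\<close> on the second.
  \<open>T_mat\<close> maps the second block into the first, so the chain needs the transpose;
  \<open>h\<close> is odd, hence \<open>v\<close> has opposite signs at \<open>0\<close> and
  \<open>h\<close>.\<close>

lemma infinite_order_q2:
  assumes "q = 2" "even p" "h \<in> {1, p - 1}"
  shows "\<not> finite_order_mat A"
proof -
  have "\<not> finite_order_mat (transpose_mat A)"
  proof (rule infinite_order_by_jordan_chain[where i = p and c = 2
        and v = "vec n (\<lambda>i. if i < p then (-1) ^ i else 0)"
        and w = "vec n (\<lambda>i. if i = p then -1 else if i = Suc p then 1 else 0)"])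
    have h: "odd h" "h < p" and idx: "n - 1 = Suc p" "n - l - 1 = p" "n = Suc (Suc p)"
      and lt: "0 < n" "h < n" "p < n" "Suc p < n"
      using assms p n h l by auto
    have rows: "row1 p = Suc p" "row1 (Suc p) = p"
      and row_less: "\<And>j. j < p \<Longrightarrow> row1 j = (if j = p - 1 then 0 else Suc j)"
      using p unfolding cycle_row_def idx by auto
    have mult: "(transpose_mat A *\<^sub>v v) $ j = v $ row1 j + (if j = Suc p then v $ 0 - v $ h else 0)
      + (if j = p then v $ h - v $ 0 else 0)" if "v \<in> carrier_vec n" "j < n" for v j
      using transpose_mult_vec_entry[OF that] unfolding idx(1,2) .
    show "transpose_mat A *\<^sub>v vec n (\<lambda>i. if i = p then -1 else if i = Suc p then 1 else 0)
        = - vec n (\<lambda>i. if i = p then -1 else if i = Suc p then 1 else 0)" (is "?M *\<^sub>v ?w = - ?w")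
    proof (rule eq_vecI)
      fix j assume "j < dim_vec (- ?w)"
      then have j: "j < n" by simp
      then consider "j = p" | "j = Suc p" | "j = p - 1" | "j < p - 1" using idx by linarith
      then show "(?M *\<^sub>v ?w) $ j = (- ?w) $ j"
        unfolding mult[OF vec_carrier j]
        by cases (use h j lt p in \<open>auto simp: rows row_less\<close>)
    qed (use A_carrier in simp)
    show "transpose_mat A *\<^sub>v vec n (\<lambda>i. if i < p then (-1) ^ i else 0)
        = - vec n (\<lambda>i. if i < p then (-1) ^ i else 0)
          + 2 \<cdot>\<^sub>v vec n (\<lambda>i. if i = p then -1 else if i = Suc p then 1 else 0)"
      (is "?M *\<^sub>v ?v = - ?v + 2 \<cdot>\<^sub>v ?w")
    proof (rule eq_vecI)
      fix j assume "j < dim_vec (- ?v + 2 \<cdot>\<^sub>v ?w)"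
      then have j: "j < n" by simp
      then consider "j = p" | "j = Suc p" | "j = p - 1" | "j < p - 1" using idx by linarith
      then show "(?M *\<^sub>v ?v) $ j = (- ?v + 2 \<cdot>\<^sub>v ?w) $ j"
        unfolding mult[OF vec_carrier j]
        by cases (use h j lt p \<open>even p\<close> in \<open>auto simp: rows row_less\<close>)
    qed (use A_carrier in simp)
  qed (use A_carrier n q in auto)
  then show ?thesis using finite_order_transpose[OF A_carrier] by blast
qed

end

theorem theorem5p3:
  fixes p q n h l :: nat and A :: "int mat"
  assumes "p \<ge> 2" and "q \<ge> 2" and "n = p + q"
    and "1 \<le> h" and "h < p" and "1 \<le> l" and "l < q"
    and "A = direct_sum_mat (C_mat p) (C_mat q) + T_mat n 1 n (h + 1) (n - l)"
    and "finite_order_mat A"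
  shows "(\<exists>B. permutation_similar A B \<and> alternating_sign_mat B) \<longleftrightarrow>
    \<not> ((p = 2 \<and> odd q \<and> q \<ge> 3 \<and> l \<in> {1, q - 1}) \<or>
       (q = 2 \<and> odd p \<and> p \<ge> 3 \<and> h \<in> {1, p - 1}))"
proof -
  interpret linked_cycles p q n h l A using assms by unfold_locales
  \<comment> \<open>Finite order excludes even \<open>q\<close> here, and an odd number that is at
    least 2 is at least 3. This turns the parity-free criterion into the stated exceptions.\<close>
  have "odd q \<and> q \<ge> 3" if "p = 2" "l \<in> {1, q - 1}"
    using infinite_order_p2 that assms(2,9) by (cases "q = 2") auto
  moreover have "odd p \<and> p \<ge> 3" if "q = 2" "h \<in> {1, p - 1}"
    using infinite_order_q2 that assms(1,9) by (cases "p = 2") auto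
  ultimately show ?thesis
    unfolding similar_to_asm_iff admissible_exists_iff by blast
qed

end
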